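(* Let $\phi\in\{\text{EF},\text{EF1},\text{EFX}\}$. Any instance $\mathcal{I}=(N,A,V)$ of $\phi$-Fair Division with Externalities with agent-item-correlated valuations can be transformed in linear time into an equivalent instance $\mathcal{I}'=(N,A,U)$ of $\phi$-Fair Division (with no externalities) with the same sets of items and agents. Here equivalent means that an allocation of $A$ to $N$ satisfies $\phi$ in $\mathcal{I}$ if and only if it satisfies $\phi$ in $\mathcal{I}'$.
   Context: An instance $(N,A,V)$ of Fair Division with Externalities consists of a set of agents $N=\{1,\dots,n\}$, a set of indivisible items $A=\{a_1,\dots,a_m\}$, and for all agents $i,j\in N$ and every item $a\in A$ a number $V_i(j,a)$: the value agent $i$ gets if item $a$ is allocated to agent $j$ (here $j=i$ is allowed; values may be negative). The task in $\phi$-Fair Division with Externalities is to decide whether there is an allocation satisfying $\phi$. Agent-item-correlated valuations: there are numbers $v_{i,a}$, $\mu_{i,a}$ ($i\in N$, $a\in A$) and $\tau_{i,j}>0$ ($i,j\in N$) such that for all $i,j\in N$ and $a\in A$, $V_i(i,a)=v_{i,a}$ and $V_i(j,a)=(1-\tau_{i,j}\mu_{i,a})\,v_{i,a}$ for $j\neq i$. An allocation of a set of items is a partition $\pi=(\pi_1,\dots,\pi_n)$ of that set into $n$ possibly empty bundles, $\pi_i$ being given to agent $i$; $\pi(a)$ denotes the agent receiving $a$. The value of $\pi$ for agent $i$ is $V_i(\pi)=\sum_a V_i(\pi(a),a)$, the sum ranging over the items allocated by $\pi$. $\pi^{i\leftrightarrow j}$ denotes the allocation obtained from $\pi$ by swapping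 the bundles of agents $i$ and $j$ and leaving the other bundles unchanged. An allocation $\pi$ of $A$ is: - envy-free (EF) if $V_i(\pi)\ge V_i(\pi^{i\leftrightarrow j})$ for every pair of agents $i,j\in N$; - envy-free up to one item (EF1) if for every pair of agents $i,j\in N$ there is an item $a\in A$ such that the allocation $\lambda$ (of $A\setminus\{a\}$) with $\lambda_\ell=\pi_\ell\setminus\{a\}$ for all $\ell\in N$ satisfies $V_i(\lambda)\ge V_i(\lambda^{i\leftrightarrow j})$; - envy-free up to any item (EFX) if for every pair of agents $i,j\in N$ with $V_i(\pi)<V_i(\pi^{i\leftrightarrow j})$ the following holds: for any item $a\in A$ and the allocation $\lambda$ with $\lambda_\ell=\pi_\ell\setminus\{a\}$ for all $\ell\in N$, if $V_i(\lambda)-V_i(\lambda^{i\leftrightarrow j})>V_i(\pi)-V_i(\pi^{i\leftrightarrow j})$, then $V_i(\lambda)\ge V_i(\lambda^{i\leftrightarrow j})$. An instance $(N,A,U)$ of Fair Division with no externalities consists of additive valuations $U_i(a)$ ($i\in N$, $a\in A$; of arbitrary sign): agent $i$ gets value $U_i(\pi)=\sum_{a\in\pi_i}U_i(a)$ from allocation $\pi$. The notions EF, EF1, EFX for it are those above, where agent $i$ gets value $U_i(a)$ if item $a$ is allocated to $i$ and value $0$ if $a$ is allocated to any other agent. *)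

theory Defs
  imports Complex_Main "HOL-Library.Disjoint_Sets"
begin

section \<open>Fair division with externalities\<close>

text \<open>
  \<open>V i j a\<close> is the value that agent \<open>i\<close> gets if item \<open>a\<close> is allocated to agent \<open>j\<close>.
  An allocation is given by its bundles \<open>\<pi> i\<close>, \<open>i \<in> N\<close>; only its values on \<open>N\<close> matter.
\<close>

definition allocation :: "'i set \<Rightarrow> 'a set \<Rightarrow> ('i \<Rightarrow> 'a set) \<Rightarrow> bool" where
  "allocation N A \<pi> \<longleftrightarrow> disjoint_family_on \<pi> N \<and> (\<Union>i\<in>N. \<pi> i) = A"

definition owner :: "'i set \<Rightarrow> ('i \<Rightarrow> 'a set) \<Rightarrow> 'a \<Rightarrow> 'i" where
  "owner N \<pi> a = (THE i. i \<in> N \<and> a \<in> \<pi> i)"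

definition alloc_value ::
    "'i set \<Rightarrow> ('i \<Rightarrow> 'i \<Rightarrow> 'a \<Rightarrow> real) \<Rightarrow> 'i \<Rightarrow> ('i \<Rightarrow> 'a set) \<Rightarrow> real" where
  "alloc_value N V i \<pi> = (\<Sum>a\<in>(\<Union>l\<in>N. \<pi> l). V i (owner N \<pi> a) a)"

definition swap_bundles :: "'i \<Rightarrow> 'i \<Rightarrow> ('i \<Rightarrow> 'a set) \<Rightarrow> 'i \<Rightarrow> 'a set" where
  "swap_bundles i j \<pi> = \<pi>(i := \<pi> j, j := \<pi> i)"

definition remove_item :: "'a \<Rightarrow> ('i \<Rightarrow> 'a set) \<Rightarrow> 'i \<Rightarrow> 'a set" where
  "remove_item a \<pi> = (\<lambda>l. \<pi> l - {a})"

definition EF ::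
    "'i set \<Rightarrow> 'a set \<Rightarrow> ('i \<Rightarrow> 'i \<Rightarrow> 'a \<Rightarrow> real) \<Rightarrow> ('i \<Rightarrow> 'a set) \<Rightarrow> bool" where
  "EF N A V \<pi> \<longleftrightarrow>
     (\<forall>i\<in>N. \<forall>j\<in>N. alloc_value N V i \<pi> \<ge> alloc_value N V i (swap_bundles i j \<pi>))"

definition EF1 ::
    "'i set \<Rightarrow> 'a set \<Rightarrow> ('i \<Rightarrow> 'i \<Rightarrow> 'a \<Rightarrow> real) \<Rightarrow> ('i \<Rightarrow> 'a set) \<Rightarrow> bool" where
  "EF1 N A V \<pi> \<longleftrightarrow>
     (\<forall>i\<in>N. \<forall>j\<in>N. \<exists>a\<in>A. let \<rho> = remove_item a \<pi> in
        alloc_value N V i \<rho> \<ge> alloc_value N V i (swap_bundles i j \<rho>))"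

definition EFX ::
    "'i set \<Rightarrow> 'a set \<Rightarrow> ('i \<Rightarrow> 'i \<Rightarrow> 'a \<Rightarrow> real) \<Rightarrow> ('i \<Rightarrow> 'a set) \<Rightarrow> bool" where
  "EFX N A V \<pi> \<longleftrightarrow>
     (\<forall>i\<in>N. \<forall>j\<in>N. alloc_value N V i \<pi> < alloc_value N V i (swap_bundles i j \<pi>) \<longrightarrow>
        (\<forall>a\<in>A. let \<rho> = remove_item a \<pi> in
           alloc_value N V i \<rho> - alloc_value N V i (swap_bundles i j \<rho>)
             > alloc_value N V i \<pi> - alloc_value N V i (swap_bundles i j \<pi>) \<longrightarrow>
           alloc_value N V i \<rho> \<ge> alloc_value N V i (swap_bundles i j \<rho>)))"

definition agent_item_correlated ::
    "'i set \<Rightarrow> 'a set \<Rightarrow> ('i \<Rightarrow> 'i \<Rightarrow> 'a \<Rightarrow> real) \<Rightarrow> bool" where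
  "agent_item_correlated N A V \<longleftrightarrow>
     (\<exists>v \<mu> \<tau>. (\<forall>i\<in>N. \<forall>j\<in>N. \<tau> i j > 0) \<and>
        (\<forall>i\<in>N. \<forall>j\<in>N. \<forall>a\<in>A. V i i a = v i a \<and>
           (j \<noteq> i \<longrightarrow> V i j a = (1 - \<tau> i j * \<mu> i a) * v i a)))"

text \<open>Valuations without externalities, seen as valuations that ignore items given to others.\<close>

definition no_ext :: "('i \<Rightarrow> 'a \<Rightarrow> real) \<Rightarrow> 'i \<Rightarrow> 'i \<Rightarrow> 'a \<Rightarrow> real" where
  "no_ext U i j a = (if j = i then U i a else 0)"

lemma owner_eq:
  assumes "disjoint_family_on \<pi> N" "i \<in> N" "a \<in> \<pi> i"
  shows "owner N \<pi> a = i"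
  unfolding owner_def using assms by (auto simp: disjoint_family_on_def)

lemma alloc_value_no_ext:
  assumes "finite A" "allocation N A \<pi>" "i \<in> N"
  shows "alloc_value N (no_ext U) i \<pi> = (\<Sum>a\<in>\<pi> i. U i a)"
proof -
  have dj: "disjoint_family_on \<pi> N" and un: "(\<Union>l\<in>N. \<pi> l) = A"
    using assms(2) by (auto simp: allocation_def)
  have "alloc_value N (no_ext U) i \<pi> = (\<Sum>a\<in>A. if a \<in> \<pi> i then U i a else 0)"
    unfolding alloc_value_def un
  proof (rule sum.cong[OF refl])
    fix a assume "a \<in> A"
    then obtain l where l: "l \<in> N" "a \<in> \<pi> l" using un by auto
    have "a \<in> \<pi> i \<Longrightarrow> l = i"
      using owner_eq[OF dj assms(3)] owner_eq[OF dj l] by auto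
    then show "no_ext U i (owner N \<pi> a) a = (if a \<in> \<pi> i then U i a else 0)"
      using owner_eq[OF dj l] l(2) by (auto simp: no_ext_def)
  qed
  also have "\<dots> = (\<Sum>a\<in>A \<inter> \<pi> i. U i a)"
    using assms(1) by (simp add: sum.inter_restrict)
  also have "A \<inter> \<pi> i = \<pi> i" using un assms(3) by auto
  finally show ?thesis .
qed


section \<open>Unit-cost real random access machines\<close>

text \<open>
  Time is measured on a real RAM: finitely many index registers (natural numbers), finitely many
  real registers, a memory of real cells addressed through index registers, and an output tape.
  Every instruction costs one step. Index arithmetic is limited to addition and truncated
  subtraction, so that unit cost cannot be abused by building huge numbers quickly.
  Instructions with a target register name the target first. Jumps are to absolute positions;
  the machine halts by leaving the program.
\<close>

datatype instr =
    IConst nat nat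
  | IAdd nat nat nat
  | ISub nat nat nat
  | RConst nat int
  | RAdd nat nat nat
  | RSub nat nat nat
  | RMul nat nat nat
  | RDiv nat nat nat
  | Load nat nat
  | Store nat nat
  | Write nat
  | Jump nat
  | JumpILess nat nat nat
  | JumpRLess nat nat nat

record ram =
  pc :: nat
  ireg :: "nat \<Rightarrow> nat"
  rreg :: "nat \<Rightarrow> real"
  mem :: "nat \<Rightarrow> real"
  out :: "real list"

fun exec :: "instr \<Rightarrow> ram \<Rightarrow> ram" where
  "exec (IConst x k) s = s\<lparr>pc := pc s + 1, ireg := (ireg s)(x := k)\<rparr>"
| "exec (IAdd x y z) s = s\<lparr>pc := pc s + 1, ireg := (ireg s)(x := ireg s y + ireg s z)\<rparr>"
| "exec (ISub x y z) s = s\<lparr>pc := pc s + 1, ireg := (ireg s)(x := ireg s y - ireg s z)\<rparr>"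
| "exec (RConst x k) s = s\<lparr>pc := pc s + 1, rreg := (rreg s)(x := of_int k)\<rparr>"
| "exec (RAdd x y z) s = s\<lparr>pc := pc s + 1, rreg := (rreg s)(x := rreg s y + rreg s z)\<rparr>"
| "exec (RSub x y z) s = s\<lparr>pc := pc s + 1, rreg := (rreg s)(x := rreg s y - rreg s z)\<rparr>"
| "exec (RMul x y z) s = s\<lparr>pc := pc s + 1, rreg := (rreg s)(x := rreg s y * rreg s z)\<rparr>"
| "exec (RDiv x y z) s = s\<lparr>pc := pc s + 1, rreg := (rreg s)(x := rreg s y / rreg s z)\<rparr>"
| "exec (Load x y) s = s\<lparr>pc := pc s + 1, rreg := (rreg s)(x := mem s (ireg s y))\<rparr>"
| "exec (Store x y) s = s\<lparr>pc := pc s + 1, mem := (mem s)(ireg s x := rreg s y)\<rparr>"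
| "exec (Write x) s = s\<lparr>pc := pc s + 1, out := out s @ [rreg s x]\<rparr>"
| "exec (Jump l) s = s\<lparr>pc := l\<rparr>"
| "exec (JumpILess x y l) s = s\<lparr>pc := (if ireg s x < ireg s y then l else pc s + 1)\<rparr>"
| "exec (JumpRLess x y l) s = s\<lparr>pc := (if rreg s x < rreg s y then l else pc s + 1)\<rparr>"

definition step :: "instr list \<Rightarrow> ram \<Rightarrow> ram" where
  "step P s = (if pc s < length P then exec (P ! pc s) s else s)"

text \<open>The input consists of natural numbers \<open>ns\<close> (in the first index registers) and reals \<open>xs\<close>
  (in the first memory cells); everything else is zero.\<close>

definition init :: "nat list \<Rightarrow> real list \<Rightarrow> ram" where
  "init ns xs = \<lparr>pc = 0,
     ireg = (\<lambda>k. if k < length ns then ns ! k else 0),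
     rreg = (\<lambda>_. 0),
     mem = (\<lambda>k. if k < length xs then xs ! k else 0),
     out = []\<rparr>"

definition outputs_within :: "instr list \<Rightarrow> nat list \<times> real list \<Rightarrow> nat \<Rightarrow> real list \<Rightarrow> bool" where
  "outputs_within P inp T ys \<longleftrightarrow>
     (\<exists>t\<le>T. let s = (step P ^^ t) (init (fst inp) (snd inp)) in length P \<le> pc s \<and> out s = ys)"

definition input_size :: "nat list \<times> real list \<Rightarrow> nat" where
  "input_size inp = length (fst inp) + length (snd inp)"


section \<open>Encoding of instances\<close>

text \<open>The agents are \<open>{1..n}\<close>, and item \<open>a\<^sub>k\<close> is represented by its index \<open>k \<in> {1..m}\<close>.
  As agents and items are kept, a transformed instance is represented by the table of its values.\<close>

definition encode_ext ::
    "nat \<Rightarrow> nat \<Rightarrow> (nat \<Rightarrow> nat \<Rightarrow> nat \<Rightarrow> real) \<Rightarrow> nat list \<times> real list" where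
  "encode_ext n m V =
     ([n, m], [V i j a. i \<leftarrow> [1..<Suc n], j \<leftarrow> [1..<Suc n], a \<leftarrow> [1..<Suc m]])"

definition encode_no_ext :: "nat \<Rightarrow> nat \<Rightarrow> (nat \<Rightarrow> nat \<Rightarrow> real) \<Rightarrow> real list" where
  "encode_no_ext n m U = [U i a. i \<leftarrow> [1..<Suc n], a \<leftarrow> [1..<Suc m]]"

end

theory Submission imports Defs begin

text \<open>
  Swapping the bundles of \<open>i\<close> and \<open>j\<close> changes the value of agent \<open>i\<close> by the difference of
  \<open>V\<^sub>i(i,a) - V\<^sub>i(j,a) = \<tau>\<^sub>i\<^sub>j \<mu>\<^sub>i\<^sub>a v\<^sub>i\<^sub>a\<close> summed over the two bundles. Up to the positive factor \<open>\<tau>\<^sub>i\<^sub>j\<close>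
  this does not depend on \<open>j\<close>, and all three fairness notions are invariant under scaling the gain
  of each ordered pair of agents by a positive constant. As \<open>\<tau>\<close>, \<open>\<mu>\<close> and \<open>v\<close> are not part of the
  input, the values \<open>U\<^sub>i(a) = V\<^sub>i(i,a) - V\<^sub>i(k,a)\<close> for one fixed agent \<open>k \<noteq> i\<close> are used instead of
  \<open>\<mu>\<^sub>i\<^sub>a v\<^sub>i\<^sub>a\<close>; they differ from them by the factor \<open>\<tau>\<^sub>i\<^sub>k\<close>.
\<close>

section \<open>Invariance of the fairness notions\<close>

text \<open>For fixed \<open>i\<close> and \<open>j\<close>, each of the three notions only looks at
  signs and comparisons of this quantity.\<close>

definition swap_gain ::
    "'i set \<Rightarrow> ('i \<Rightarrow> 'i \<Rightarrow> 'a \<Rightarrow> real) \<Rightarrow> 'i \<Rightarrow> 'i \<Rightarrow> ('i \<Rightarrow> 'a set) \<Rightarrow> real" where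
  "swap_gain N V i j \<pi> = alloc_value N V i \<pi> - alloc_value N V i (swap_bundles i j \<pi>)"

lemma EF_swap_gain: "EF N A V \<pi> \<longleftrightarrow> (\<forall>i\<in>N. \<forall>j\<in>N. swap_gain N V i j \<pi> \<ge> 0)"
  by (simp add: EF_def swap_gain_def)

lemma EF1_swap_gain:
  "EF1 N A V \<pi> \<longleftrightarrow> (\<forall>i\<in>N. \<forall>j\<in>N. \<exists>a\<in>A. swap_gain N V i j (remove_item a \<pi>) \<ge> 0)"
  by (simp add: EF1_def swap_gain_def Let_def)

lemma EFX_swap_gain:
  "EFX N A V \<pi> \<longleftrightarrow>
     (\<forall>i\<in>N. \<forall>j\<in>N. swap_gain N V i j \<pi> < 0 \<longrightarrow>
        (\<forall>a\<in>A. swap_gain N V i j \<pi> < swap_gain N V i j (remove_item a \<pi>) \<longrightarrow>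
           swap_gain N V i j (remove_item a \<pi>) \<ge> 0))"
  by (simp add: EFX_def swap_gain_def Let_def)

lemma allocation_remove_item:
  "allocation N A \<pi> \<Longrightarrow> allocation N (A - {a}) (remove_item a \<pi>)"
  by (auto simp: allocation_def remove_item_def disjoint_family_on_def)

text \<open>EFX compares the gains before and after removing an item, so one factor per ordered pair
  must serve all allocations of subsets of \<open>A\<close>.\<close>

lemma fairness_scale_invariant:
  assumes "\<phi> \<in> {EF, EF1, EFX}"
    and scale: "\<And>i j. i \<in> N \<Longrightarrow> j \<in> N \<Longrightarrow>
      \<exists>t>0. \<forall>B\<subseteq>A. \<forall>\<rho>. allocation N B \<rho> \<longrightarrow> swap_gain N V i j \<rho> = t * swap_gain N W i j \<rho>"
    and \<pi>: "allocation N A \<pi>"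
  shows "\<phi> N A V \<pi> = \<phi> N A W \<pi>"
proof -
  obtain t where t: "\<And>i j. i \<in> N \<Longrightarrow> j \<in> N \<Longrightarrow> t i j > 0"
    and eq: "\<And>i j B \<rho>. i \<in> N \<Longrightarrow> j \<in> N \<Longrightarrow> B \<subseteq> A \<Longrightarrow> allocation N B \<rho> \<Longrightarrow>
      swap_gain N V i j \<rho> = t i j * swap_gain N W i j \<rho>"
    using scale by metis
  have whole: "swap_gain N V i j \<pi> = t i j * swap_gain N W i j \<pi>"
    and removed: "swap_gain N V i j (remove_item a \<pi>) = t i j * swap_gain N W i j (remove_item a \<pi>)"
    if "i \<in> N" "j \<in> N" for i j a
    using that eq \<pi> allocation_remove_item[OF \<pi>] by blast+
  have nonneg: "0 \<le> t i j * x \<longleftrightarrow> 0 \<le> x" and neg: "t i j * x < 0 \<longleftrightarrow> x < 0"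
    and less: "t i j * x < t i j * y \<longleftrightarrow> x < y" if "i \<in> N" "j \<in> N" for i j x y
    using t[OF that] by (auto simp: zero_le_mult_iff mult_less_0_iff)
  note simps = whole removed nonneg neg less
  have "EF N A V \<pi> = EF N A W \<pi>"
    unfolding EF_swap_gain by (intro ball_cong refl) (simp add: simps)
  moreover have "EF1 N A V \<pi> = EF1 N A W \<pi>"
    unfolding EF1_swap_gain by (intro ball_cong refl) (simp add: simps)
  moreover have "EFX N A V \<pi> = EFX N A W \<pi>"
    unfolding EFX_swap_gain by (intro ball_cong refl) (simp add: simps)
  ultimately show ?thesis using assms(1) by auto
qed

section \<open>Swap gains as sums over the two exchanged bundles\<close>

lemma alloc_value_bundles:
  assumes "finite N" "finite A" "allocation N A \<pi>"
  shows "alloc_value N V i \<pi> = (\<Sum>l\<in>N. \<Sum>a\<in>\<pi> l. V i l a)"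
proof -
  have dj: "disjoint_family_on \<pi> N" and fin: "\<forall>l\<in>N. finite (\<pi> l)"
    using assms by (auto simp: allocation_def intro: finite_subset)
  have "alloc_value N V i \<pi> = (\<Sum>l\<in>N. \<Sum>a\<in>\<pi> l. V i (owner N \<pi> a) a)"
    unfolding alloc_value_def
    by (rule sum.UNION_disjoint) (use assms(1) fin dj in \<open>auto simp: disjoint_family_on_def\<close>)
  then show ?thesis by (simp add: owner_eq[OF dj])
qed

lemma allocation_swap_bundles:
  assumes "allocation N A \<pi>" "i \<in> N" "j \<in> N"
  shows "allocation N A (swap_bundles i j \<pi>)"
  using assms unfolding allocation_def disjoint_family_on_def swap_bundles_def
  by (auto split: if_splits)

text \<open>The bundles of all other agents cancel; items of \<open>\<pi> i\<close> move from
  \<open>i\<close> to \<open>j\<close> and items of \<open>\<pi> j\<close> the other way.\<close>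

lemma swap_gain_eq:
  assumes fin: "finite N" "finite A" and \<pi>: "allocation N A \<pi>" and ij: "i \<in> N" "j \<in> N" "i \<noteq> j"
  shows "swap_gain N V i j \<pi> =
    (\<Sum>a\<in>\<pi> i. V i i a - V i j a) - (\<Sum>a\<in>\<pi> j. V i i a - V i j a)"
proof -
  have split: "sum f N = f i + f j + sum f (N - {i, j})" for f :: "'a \<Rightarrow> real"
  proof -
    have "sum f N = f i + sum f (N - {i})" using fin ij by (simp add: sum.remove)
    also have "sum f (N - {i}) = f j + sum f (N - {i} - {j})" using fin ij by (simp add: sum.remove)
    also have "N - {i} - {j} = N - {i, j}" by auto
    finally show ?thesis by simp
  qed
  have rest: "(\<Sum>l\<in>N - {i, j}. \<Sum>a\<in>swap_bundles i j \<pi> l. V i l a) = (\<Sum>l\<in>N - {i, j}. \<Sum>a\<in>\<pi> l. V i l a)"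
    by (rule sum.cong) (auto simp: swap_bundles_def)
  show ?thesis
    unfolding swap_gain_def alloc_value_bundles[OF fin \<pi>]
      alloc_value_bundles[OF fin allocation_swap_bundles[OF \<pi> ij(1,2)]] split rest
    using ij by (simp add: swap_bundles_def sum_subtractf)
qed

lemma swap_gain_self: "swap_gain N V i i \<pi> = 0"
  by (simp add: swap_gain_def swap_bundles_def)

text \<open>The condition on \<open>k\<close> is vacuous for a single agent, where every swap gain
  is zero.\<close>

lemma correlated_equivalent:
  assumes \<phi>: "\<phi> \<in> {EF, EF1, EFX}" and fin: "finite N" "finite A"
    and corr: "agent_item_correlated N A V"
    and ref: "\<And>i j. i \<in> N \<Longrightarrow> j \<in> N \<Longrightarrow> i \<noteq> j \<Longrightarrow> k i \<in> N \<and> k i \<noteq> i"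
    and \<pi>: "allocation N A \<pi>"
  shows "\<phi> N A V \<pi> = \<phi> N A (no_ext (\<lambda>i a. V i i a - V i (k i) a)) \<pi>"
proof (rule fairness_scale_invariant[OF \<phi> _ \<pi>])
  let ?W = "no_ext (\<lambda>i a. V i i a - V i (k i) a)"
  fix i j assume ij: "i \<in> N" "j \<in> N"
  obtain v \<mu> \<tau> where pos: "\<And>i j. i \<in> N \<Longrightarrow> j \<in> N \<Longrightarrow> \<tau> i j > (0::real)"
    and V: "\<And>i j a. i \<in> N \<Longrightarrow> j \<in> N \<Longrightarrow> a \<in> A \<Longrightarrow> j \<noteq> i \<Longrightarrow> V i i a - V i j a = \<tau> i j * (\<mu> i a * v i a)"
  proof -
    obtain v \<mu> \<tau> where "\<forall>i\<in>N. \<forall>j\<in>N. \<tau> i j > (0::real)" and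
      "\<forall>i\<in>N. \<forall>j\<in>N. \<forall>a\<in>A. V i i a = v i a \<and> (j \<noteq> i \<longrightarrow> V i j a = (1 - \<tau> i j * \<mu> i a) * v i a)"
      using corr unfolding agent_item_correlated_def by blast
    then show ?thesis by (intro that[of \<tau> \<mu> v]) (auto simp: left_diff_distrib)
  qed
  show "\<exists>t>0. \<forall>B\<subseteq>A. \<forall>\<rho>. allocation N B \<rho> \<longrightarrow> swap_gain N V i j \<rho> = t * swap_gain N ?W i j \<rho>"
  proof (cases "i = j")
    case True
    then show ?thesis by (auto simp: swap_gain_self intro: exI[of _ 1])
  next
    case False
    \<comment> \<open>This trades the factor \<open>\<tau> i (k i)\<close> contained in the new
      values for \<open>\<tau> i j\<close>.\<close>
    define t where "t = \<tau> i j / \<tau> i (k i)"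
    have k: "k i \<in> N" "k i \<noteq> i" using ref[OF ij False] by auto
    have ratio: "V i i a - V i j a = t * (V i i a - V i (k i) a)" if "a \<in> A" for a
      using V[OF ij that] V[OF ij(1) k(1) that] False k pos[OF ij(1) k(1)] by (simp add: t_def)
    have "swap_gain N V i j \<rho> = t * swap_gain N ?W i j \<rho>" if B: "B \<subseteq> A" and \<rho>: "allocation N B \<rho>" for B \<rho>
    proof -
      have sub: "\<rho> i \<subseteq> A" "\<rho> j \<subseteq> A" using B \<rho> ij by (auto simp: allocation_def)
      \<comment> \<open>Since \<open>j \<noteq> i\<close>, \<open>?W i j a\<close> is zero and the
        difference on the right is just the new value of \<open>a\<close>.\<close>
      have "(\<Sum>a\<in>\<rho> l. V i i a - V i j a) = t * (\<Sum>a\<in>\<rho> l. ?W i i a - ?W i j a)" if "\<rho> l \<subseteq> A" for l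
        unfolding sum_distrib_left using that ratio False
        by (intro sum.cong) (auto simp: no_ext_def)
      then show ?thesis
        using swap_gain_eq[OF fin(1) finite_subset[OF B fin(2)] \<rho> ij False] sub
        by (simp add: right_diff_distrib)
    qed
    moreover have "t > 0" using pos ij k by (simp add: t_def)
    ultimately show ?thesis by blast
  qed
qed

section \<open>The transformation on the random access machine\<close>

text \<open>A choice whose table position is easy to compute. For \<open>n = 1\<close> it returns
  the agent itself, and the new values are all zero.\<close>

definition ref_agent :: "nat \<Rightarrow> nat \<Rightarrow> nat" where
  "ref_agent n i = (if i = 1 then n else 1)"

text \<open>
  Index registers: 0 and 1 hold \<open>n\<close> and \<open>m\<close>, 2 holds \<open>0\<close>, 3 holds \<open>n * m\<close> from position 8 on,
  5 holds \<open>1\<close>, 8 and 7 point to the entries of agent \<open>i\<close> and its reference agent, 9 and 10 count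
  agents and items, 11 holds the start of the table of agent \<open>i\<close>. The first four instructions make
  the running time constant on empty tables, where \<open>n\<close> or \<open>m\<close> may exceed the input size.
\<close>

definition prog :: "instr list" where
  "prog =
    [JumpILess 2 0 2,
     Jump 23,
     JumpILess 2 1 4,
     Jump 23,
     IConst 5 1,
     IAdd 3 3 1,
     IAdd 4 4 5,
     JumpILess 4 0 5,
     ISub 7 3 1,
     IConst 10 0,
     Load 0 8,
     Load 1 7,
     RSub 0 0 1,
     Write 0,
     IAdd 8 8 5,
     IAdd 7 7 5,
     IAdd 10 10 5,
     JumpILess 10 1 10,
     IAdd 8 8 3,
     IAdd 11 11 3,
     IAdd 7 11 2,
     IAdd 9 9 5,
     JumpILess 9 0 9]"

section \<open>Loops: effect and exact running time\<close>

text \<open>Every loop body here takes a fixed number \<open>T\<close> of steps, so an invariant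
  also yields the exact time.\<close>

lemma funpow_invariant:
  assumes "\<And>k s. k < n \<Longrightarrow> I k s \<Longrightarrow> I (Suc k) ((f ^^ T) s)" and "I 0 s"
  shows "I n ((f ^^ (n * T)) s)"
proof -
  have "k \<le> n \<Longrightarrow> I k ((f ^^ (k * T)) s)" for k
  proof (induction k)
    case (Suc k)
    then show ?case using assms(1)[of k "(f ^^ (k * T)) s"] by (simp add: funpow_add)
  qed (simp add: assms(2))
  then show ?thesis by simp
qed

lemma funpow_numeral: "(f ^^ numeral k) x = (f ^^ pred_numeral k) (f x)"
  by (simp add: numeral_eq_Suc funpow_swap1)

text \<open>The program is abstracted to \<open>P\<close> so that the simplifier unfolds it only where an
  instruction is fetched.\<close>

lemma step_prog:
  "prog = P \<Longrightarrow> k < 23 \<Longrightarrow> step prog \<lparr>pc = k, ireg = f, rreg = g, mem = M, out = ys\<rparr> =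
    exec (P ! k) \<lparr>pc = k, ireg = f, rreg = g, mem = M, out = ys\<rparr>"
  by (auto simp: step_def prog_def)

lemmas run_simps = funpow_numeral step_prog[OF prog_def]

text \<open>Index registers cannot be multiplied, so \<open>n * m\<close> is built by
  \<open>n\<close> additions of \<open>m\<close>. The test comes last, hence
  \<open>n > 0\<close>.\<close>

lemma product_loop:
  assumes "pc s = 5" "ireg s = (\<lambda>_. 0)(0 := n, 1 := m, 5 := 1)" "n > 0"
    and s': "s' = (step prog ^^ (n * 3)) s"
  shows "pc s' = 8" "ireg s' = (\<lambda>_. 0)(0 := n, 1 := m, 5 := 1, 3 := n * m, 4 := n)"
    "mem s' = mem s" "out s' = out s"
proof -
  let ?I = "\<lambda>k (u :: ram). pc u = (if k < n then 5 else 8) \<and>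
    ireg u = (\<lambda>_. 0)(0 := n, 1 := m, 5 := 1, 3 := k * m, 4 := k) \<and> mem u = mem s \<and> out u = out s"
  have "?I n s'"
    unfolding s'
  proof (rule funpow_invariant[where I = ?I])
    fix k u assume "k < n" "?I k u"
    then show "?I (Suc k) ((step prog ^^ 3) u)"
      by (cases u) (auto simp: run_simps fun_eq_iff)
  qed (use assms in auto)
  then show "pc s' = 8" "ireg s' = (\<lambda>_. 0)(0 := n, 1 := m, 5 := 1, 3 := n * m, 4 := n)"
    "mem s' = mem s" "out s' = out s" by auto
qed

lemma item_loop:
  assumes "pc s = 10" "ireg s 1 = m" "ireg s 5 = 1" "ireg s 8 = p" "ireg s 7 = q" "ireg s 10 = 0" "m > 0"
    and s': "s' = (step prog ^^ (m * 8)) s"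
  shows "pc s' = 18" "ireg s' = (ireg s)(8 := p + m, 7 := q + m, 10 := m)"
    "mem s' = mem s" "out s' = out s @ map (\<lambda>a. mem s (p + a) - mem s (q + a)) [0..<m]"
proof -
  let ?I = "\<lambda>k (u :: ram). pc u = (if k < m then 10 else 18) \<and>
    ireg u = (ireg s)(8 := p + k, 7 := q + k, 10 := k) \<and>
    mem u = mem s \<and> out u = out s @ map (\<lambda>a. mem s (p + a) - mem s (q + a)) [0..<k]"
  have "?I m s'"
    unfolding s'
  proof (rule funpow_invariant[where I = ?I])
    fix k u assume "k < m" "?I k u"
    then show "?I (Suc k) ((step prog ^^ 8) u)"
      using assms(1-7) by (cases u) (auto simp: run_simps fun_eq_iff)
  qed (use assms in auto)
  then show "pc s' = 18" "ireg s' = (ireg s)(8 := p + m, 7 := q + m, 10 := m)"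
    "mem s' = mem s" "out s' = out s @ map (\<lambda>a. mem s (p + a) - mem s (q + a)) [0..<m]" by auto
qed

text \<open>Start of the entries of the reference agent of agent \<open>i + 1\<close>.\<close>

definition ref_pos :: "nat \<Rightarrow> nat \<Rightarrow> nat \<Rightarrow> nat" where
  "ref_pos n m i = (if i = 0 then n * m - m else i * (n * m))"

text \<open>Agents count from 0 here: \<open>i * (n * m) + i * m\<close> is where the block of the
  values \<open>V i i\<close> starts.\<close>

definition row :: "nat \<Rightarrow> nat \<Rightarrow> (nat \<Rightarrow> real) \<Rightarrow> nat \<Rightarrow> real list" where
  "row n m M i = map (\<lambda>a. M (i * (n * m + m) + a) - M (ref_pos n m i + a)) [0..<m]"

lemma agent_loop:
  assumes s: "pc s = 9" "ireg s = (\<lambda>_. 0)(0 := n, 1 := m, 5 := 1, 3 := n * m, 4 := n, 7 := n * m - m)"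
      "out s = []"
    and pos: "n > 0" "m > 0"
    and s': "s' = (step prog ^^ (n * (5 + (m * 8 + 1)))) s"
  shows "pc s' = 23" "out s' = concat (map (row n m (mem s)) [0..<n])"
proof -
  let ?I = "\<lambda>i (u :: ram). pc u = (if i < n then 9 else 23) \<and>
    ireg u 0 = n \<and> ireg u 1 = m \<and> ireg u 2 = 0 \<and> ireg u 3 = n * m \<and> ireg u 5 = 1 \<and>
    ireg u 7 = ref_pos n m i \<and> ireg u 8 = i * (n * m + m) \<and> ireg u 9 = i \<and> ireg u 11 = i * (n * m) \<and>
    mem u = mem s \<and> out u = concat (map (row n m (mem s)) [0..<i])"
  have "?I n s'"
    unfolding s'
  proof (rule funpow_invariant[where I = ?I])
    fix i u assume i: "i < n" and u: "?I i u"
    define u1 where "u1 = step prog u"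
    define u2 where "u2 = (step prog ^^ (m * 8)) u1"
    have u1: "pc u1 = 10" "ireg u1 = (ireg u)(10 := 0)" "mem u1 = mem s" "out u1 = out u"
      using u i unfolding u1_def by (cases u; simp add: run_simps)+
    have u2: "pc u2 = 18"
        "ireg u2 = (ireg u)(8 := i * (n * m + m) + m, 7 := ref_pos n m i + m, 10 := m)"
        "mem u2 = mem s" "out u2 = out u @ row n m (mem s) i"
      using item_loop[OF u1(1) _ _ _ _ _ pos(2) u2_def, of "i * (n * m + m)" "ref_pos n m i"] u u1
      by (auto simp: row_def)
    \<comment> \<open>The item loop left register 8 one block further; adding \<open>n * m\<close>
      reaches the next diagonal block. From the second agent on, the reference block starts the
      agent's table.\<close>
    have "?I (Suc i) ((step prog ^^ 5) u2)"
      using u u2 i by (cases u2) (auto simp: run_simps ref_pos_def)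
    moreover have "(step prog ^^ (5 + (m * 8 + 1))) u = (step prog ^^ 5) u2"
      unfolding u1_def u2_def by (simp only: funpow_add o_apply One_nat_def funpow.simps id_apply)
    ultimately show "?I (Suc i) ((step prog ^^ (5 + (m * 8 + 1))) u)" by simp
  qed (use s pos in \<open>auto simp: ref_pos_def\<close>)
  then show "pc s' = 23" "out s' = concat (map (row n m (mem s)) [0..<n])" by auto
qed

lemma length_prog: "length prog = 23"
  by (simp add: prog_def)

lemma prog_output:
  assumes "n > 0" "m > 0"
  shows "outputs_within prog ([n, m], xs) (3 + 3 * n + 1 + n * (5 + (m * 8 + 1)))
    (concat (map (row n m (\<lambda>k. if k < length xs then xs ! k else 0)) [0..<n]))"
proof -
  \<comment> \<open>For positive \<open>n\<close> and \<open>m\<close> both tests skip the exits, so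
    three instructions precede the loop.\<close>
  define s1 where "s1 = (step prog ^^ 3) (init [n, m] xs)"
  define s2 where "s2 = (step prog ^^ (n * 3)) s1"
  define s3 where "s3 = step prog s2"
  define s4 where "s4 = (step prog ^^ (n * (5 + (m * 8 + 1)))) s3"
  define M where "M = (\<lambda>k. if k < length xs then xs ! k else 0)"
  have "ireg (init [n, m] xs) = (\<lambda>_. 0)(0 := n, 1 := m)"
    by (auto simp: init_def fun_eq_iff nth_Cons split: nat.split)
  then have "init [n, m] xs = \<lparr>pc = 0, ireg = (\<lambda>_. 0)(0 := n, 1 := m), rreg = (\<lambda>_. 0), mem = M, out = []\<rparr>"
    by (simp add: init_def M_def)
  then have s1: "pc s1 = 5" "ireg s1 = (\<lambda>_. 0)(0 := n, 1 := m, 5 := 1)" "mem s1 = M" "out s1 = []"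
    using assms by (simp_all add: s1_def run_simps)
  note s2 = product_loop[OF s1(1,2) assms(1) s2_def, unfolded s1(3,4)]
  have s3: "pc s3 = 9" "ireg s3 = (\<lambda>_. 0)(0 := n, 1 := m, 5 := 1, 3 := n * m, 4 := n, 7 := n * m - m)"
      "mem s3 = M" "out s3 = []"
    using s2 unfolding s3_def by (cases s2; simp add: run_simps)+
  note s4 = agent_loop[OF s3(1,2,4) assms s4_def, unfolded s3(3)]
  have "(step prog ^^ (n * (5 + (m * 8 + 1)) + (1 + (n * 3 + 3)))) (init [n, m] xs) = s4"
    unfolding s1_def s2_def s3_def s4_def
    by (simp only: funpow_add o_apply One_nat_def funpow.simps id_apply)
  then show ?thesis
    unfolding outputs_within_def
    by (intro exI[of _ "n * (5 + (m * 8 + 1)) + (1 + (n * 3 + 3))"]) (simp add: s4 M_def length_prog)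
qed

lemma prog_output_empty:
  assumes "n = 0 \<or> m = 0"
  shows "outputs_within prog ([n, m], xs) 3 []"
proof -
  obtain f g M where init: "init [n, m] xs = \<lparr>pc = 0, ireg = f, rreg = g, mem = M, out = []\<rparr>"
    and f: "f 0 = n" "f 1 = m" "f 2 = 0"
    by (simp add: init_def)
  show ?thesis
  proof (cases "n = 0")
    case True
    then show ?thesis
      using init f unfolding outputs_within_def
      by (intro exI[of _ 2]) (simp add: run_simps length_prog)
  next
    case False
    then show ?thesis
      using init f assms unfolding outputs_within_def
      by (intro exI[of _ 3]) (simp add: run_simps length_prog)
  qed
qed

section \<open>The table of an instance\<close>

lemma length_concat_map_const:
  "(\<And>x. x \<in> set xs \<Longrightarrow> length (f x) = l) \<Longrightarrow> length (concat (map f xs)) = length xs * l"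
  by (induction xs) auto

lemma nth_concat_map_const:
  assumes "\<And>x. x \<in> set xs \<Longrightarrow> length (f x) = l" "i < length xs" "r < l"
  shows "concat (map f xs) ! (i * l + r) = f (xs ! i) ! r"
  using assms
proof (induction xs arbitrary: i)
  case (Cons x xs)
  then show ?case by (cases i) (auto simp: nth_append)
qed simp

lemma snd_encode_ext:
  "snd (encode_ext n m V) = concat (map (\<lambda>i. concat (map (\<lambda>j. map (V i j) [1..<Suc m]) [1..<Suc n])) [1..<Suc n])"
  by (simp add: encode_ext_def)

lemma length_encode_ext: "length (snd (encode_ext n m V)) = n * (n * m)"
  unfolding snd_encode_ext by (simp add: length_concat_map_const del: upt_Suc)

lemma nth_encode_ext:
  assumes "i < n" "j < n" "a < m"
  shows "snd (encode_ext n m V) ! (i * (n * m) + (j * m + a)) = V (Suc i) (Suc j) (Suc a)"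
proof -
  have "j * m + a < Suc j * m" using assms by simp
  also have "\<dots> \<le> n * m" using assms by (intro mult_le_mono1) simp
  finally have "j * m + a < n * m" .
  then show ?thesis
    using assms unfolding snd_encode_ext
    by (simp add: nth_concat_map_const length_concat_map_const del: upt_Suc)
qed

lemma row_encode_ext:
  assumes i: "i < n" and M: "\<And>k. k < n * (n * m) \<Longrightarrow> M k = snd (encode_ext n m V) ! k"
  shows "row n m M i =
    map (\<lambda>a. V (Suc i) (Suc i) a - V (Suc i) (ref_agent n (Suc i)) a) [1..<Suc m]"
proof -
  have entry: "M (i * (n * m) + (j * m + a)) = V (Suc i) (Suc j) (Suc a)" if "j < n" "a < m" for j a
  proof -
    have "j * m + a < Suc j * m" using that by simp
    also have "\<dots> \<le> n * m" using that by (intro mult_le_mono1) simp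
    \<comment> \<open>\<open>M\<close> is known only inside the table, so the index must be
      bounded.\<close>
    finally have "i * (n * m) + (j * m + a) < Suc i * (n * m)" by simp
    also have "\<dots> \<le> n * (n * m)" using i by (intro mult_le_mono1) simp
    finally show ?thesis using M nth_encode_ext[OF i that] by simp
  qed
  have own: "M (i * (n * m + m) + a) = V (Suc i) (Suc i) (Suc a)" if "a < m" for a
    using entry[OF i that] by (simp add: algebra_simps)
  \<comment> \<open>The first agent refers to the last block of its table, all others to the first
    block of theirs.\<close>
  have ref: "M (ref_pos n m i + a) = V (Suc i) (ref_agent n (Suc i)) (Suc a)" if "a < m" for a
    using entry[of "n - 1" a] entry[of 0 a] i that
    by (cases "i = 0") (auto simp: ref_pos_def ref_agent_def diff_mult_distrib)
  have "map (\<lambda>a. V (Suc i) (Suc i) a - V (Suc i) (ref_agent n (Suc i)) a) [1..<Suc m] =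
      map (\<lambda>a. V (Suc i) (Suc i) (Suc a) - V (Suc i) (ref_agent n (Suc i)) (Suc a)) [0..<m]"
    by (simp add: map_Suc_upt[symmetric] del: upt_Suc)
  then show ?thesis by (simp add: row_def own ref)
qed

lemma prog_transforms:
  "outputs_within prog (encode_ext n m V) (17 * input_size (encode_ext n m V))
    (encode_no_ext n m (\<lambda>i a. V i i a - V i (ref_agent n i) a))"
  (is "outputs_within _ _ _ (encode_no_ext n m ?U)")
proof -
  have mono: "outputs_within P inp T ys \<Longrightarrow> T \<le> T' \<Longrightarrow> outputs_within P inp T' ys" for P inp T T' ys
    unfolding outputs_within_def using le_trans by blast
  have enc: "encode_ext n m V = ([n, m], snd (encode_ext n m V))"
    by (simp add: encode_ext_def)
  have size: "input_size (encode_ext n m V) = 2 + n * (n * m)"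
    unfolding input_size_def length_encode_ext by (simp add: encode_ext_def)
  show ?thesis
  proof (cases "n = 0 \<or> m = 0")
    case True
    then have "encode_no_ext n m ?U = []"
      by (auto simp: encode_no_ext_def)
    then show ?thesis
      using prog_output_empty[OF True, of "snd (encode_ext n m V)"] enc size by (auto intro: mono)
  next
    case False
    then have pos: "n > 0" "m > 0" by auto
    let ?M = "\<lambda>k. if k < length (snd (encode_ext n m V)) then snd (encode_ext n m V) ! k else 0"
    have "concat (map (row n m ?M) [0..<n]) =
        concat (map (\<lambda>i. map (?U (Suc i)) [1..<Suc m]) [0..<n])"
      by (intro arg_cong[of _ _ concat] map_cong refl row_encode_ext)
        (auto simp: length_encode_ext)
    also have "\<dots> = encode_no_ext n m ?U"
      by (simp add: encode_no_ext_def map_Suc_upt[symmetric] comp_def del: upt_Suc)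
    finally have "outputs_within prog (encode_ext n m V) (3 + 3 * n + 1 + n * (5 + (m * 8 + 1)))
        (encode_no_ext n m ?U)"
      using prog_output[OF pos, of "snd (encode_ext n m V)"] enc by simp
    \<comment> \<open>The time is \<open>4 + 9 * n + 8 * (n * m)\<close>; as \<open>n\<close> and
      \<open>m\<close> are positive, the nonconstant part is at most \<open>17 * (n * m)\<close>,
      and the constant is absorbed by \<open>17 * 2\<close>.\<close>
    moreover have "3 + 3 * n + 1 + n * (5 + (m * 8 + 1)) \<le> 17 * (2 + n * (n * m))"
    proof -
      have "9 * n + 8 * (n * m) \<le> 9 * (n * m) + 8 * (n * m)"
        using pos by simp
      also have "\<dots> = 17 * (n * m)" by simp
      also have "\<dots> \<le> 17 * (n * (n * m))" using pos by simp
      finally show ?thesis by (simp add: algebra_simps)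
    qed
    ultimately show ?thesis unfolding size by (rule mono)
  qed
qed

theorem theorem5p1:
  fixes \<phi> :: "nat set \<Rightarrow> nat set \<Rightarrow> (nat \<Rightarrow> nat \<Rightarrow> nat \<Rightarrow> real) \<Rightarrow> (nat \<Rightarrow> nat set) \<Rightarrow> bool"
  assumes "\<phi> \<in> {EF, EF1, EFX}"
  shows "\<exists>(P :: instr list) (c :: nat). \<forall>(n :: nat) (m :: nat) (V :: nat \<Rightarrow> nat \<Rightarrow> nat \<Rightarrow> real).
           agent_item_correlated {1..n} {1..m} V \<longrightarrow>
           (\<exists>U :: nat \<Rightarrow> nat \<Rightarrow> real.
              outputs_within P (encode_ext n m V) (c * input_size (encode_ext n m V))
                (encode_no_ext n m U) \<and>
              (\<forall>\<pi>. allocation {1..n} {1..m} \<pi> \<longrightarrow>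
                 \<phi> {1..n} {1..m} V \<pi> = \<phi> {1..n} {1..m} (no_ext U) \<pi>))"
proof -
  have "\<phi> {1..n} {1..m} V \<pi> = \<phi> {1..n} {1..m} (no_ext (\<lambda>i a. V i i a - V i (ref_agent n i) a)) \<pi>"
    if "agent_item_correlated {1..n} {1..m} V" "allocation {1..n} {1..m} \<pi>" for n m V \<pi>
    by (rule correlated_equivalent[OF assms _ _ that(1) _ that(2)]) (auto simp: ref_agent_def)
  then show ?thesis using prog_transforms by blast
qed

end
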